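(* Let $\lambda\in\mathbb{R}$, $\lambda\neq 0$, and let $r\ge 0$ be an integer. For every integer $n\ge 0$, $$\frac{n!}{n+1}=\sum_{k=0}^{n}(-1)^{k}{n+r \brack k+r}_{r,\lambda}\beta_{k,\lambda}(r).$$
   Context: For $\lambda\in\mathbb{R}$ put $(x)_{0,\lambda}=1$, $(x)_{n,\lambda}=x(x-\lambda)\cdots(x-(n-1)\lambda)$ and $\langle x\rangle_{0,\lambda}=1$, $\langle x\rangle_{n,\lambda}=x(x+\lambda)\cdots(x+(n-1)\lambda)$ for $n\ge 1$. Also $\langle x\rangle_0=1$ and $\langle x\rangle_n=x(x+1)\cdots(x+n-1)$ for $n\ge1$. For an integer $r\ge 0$, the unsigned degenerate $r$-Stirling numbers of the first kind ${n+r \brack k+r}_{r,\lambda}$ ($0\le k\le n$) are defined by the polynomial identity in $x$: $\langle x+r\rangle_{n}=\sum_{k=0}^{n}{n+r \brack k+r}_{r,\lambda}\langle x\rangle_{k,\lambda}$ for $n\ge 0$. The degenerate exponential functions are the formal power series $e_{\lambda}^{x}(t)=\sum_{n=0}^{\infty}(x)_{n,\lambda}\frac{t^{n}}{n!}$, with $e_\lambda(t)=e_\lambda^1(t)$. The fully degenerate Bernoulli polynomials $\beta_{n,\lambda}(x)$ are defined by the formal power series identity $$\frac{\log(1+\lambda t)}{\lambda(e_{\lambda}(t)-1)}e_{\lambda}^{x}(t)=\sum_{n=0}^{\infty}\beta_{n,\lambda}(x)\frac{t^{n}}{n!},$$ where $\log(1+u)=\sum_{m\ge1}(-1)^{m-1}u^m/m$.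 *)

theory Defs
  imports "HOL-Computational_Algebra.Computational_Algebra"
begin

definition degen_falling :: "'a::comm_ring_1 \<Rightarrow> 'a \<Rightarrow> nat \<Rightarrow> 'a" where
  "degen_falling x l n = (\<Prod>i<n. x - of_nat i * l)"

definition degen_rising :: "'a::comm_ring_1 \<Rightarrow> 'a \<Rightarrow> nat \<Rightarrow> 'a" where
  "degen_rising x l n = (\<Prod>i<n. x + of_nat i * l)"

(* The rising factorials as polynomials in the indeterminate [:0, 1:]; the library's pochhammer
   is the ordinary rising factorial <x>_n. The second index is cut off at n so that
   the expansion determines a unique coefficient function.
   With this indexing, degen_rstirling1 r l n k is the number usually bracketed as
   "n + r over k + r". *)
definition degen_rstirling1_row :: "nat \<Rightarrow> real \<Rightarrow> nat \<Rightarrow> (nat \<Rightarrow> real) \<Rightarrow> bool" where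
  "degen_rstirling1_row r l n a \<longleftrightarrow>
     (\<forall>k>n. a k = 0) \<and>
     pochhammer ([:0, 1:] + of_nat r) n = (\<Sum>k=0..n. smult (a k) (degen_rising [:0, 1:] [:l:] k))"

definition degen_rstirling1 :: "nat \<Rightarrow> real \<Rightarrow> nat \<Rightarrow> nat \<Rightarrow> real" where
  "degen_rstirling1 r l n = (THE a. degen_rstirling1_row r l n a)"

definition degen_exp :: "real \<Rightarrow> real \<Rightarrow> real fps" where
  "degen_exp l x = Abs_fps (\<lambda>n. degen_falling x l n / fact n)"

(* fps_ln 1 is the series of log (1 + t). For l \<noteq> 0 numerator and denominator of the quotient
   both have subdegree 1, so the division is exact (see degen_bernoulli_gf). *)
definition full_degen_bernoulli :: "nat \<Rightarrow> real \<Rightarrow> real \<Rightarrow> real" where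
  "full_degen_bernoulli n l x =
     fact n * fps_nth ((fps_ln 1 oo (fps_const l * fps_X)) /
                       (fps_const l * (degen_exp l 1 - 1)) * degen_exp l x) n"

lemma degen_rising_poly_Suc:
  "degen_rising [:0, 1:] [:l:] (Suc k) = degen_rising [:0, 1:] [:l:] k * [:real k * l, 1:]"
  by (simp add: degen_rising_def of_nat_poly mult.commute)

lemma degen_rising_poly_monic:
  fixes l :: real
  shows "degree (degen_rising [:0, 1:] [:l:] k) = k \<and> coeff (degen_rising [:0, 1:] [:l:] k) k = 1"
proof (induction k)
  case 0
  show ?case by (simp add: degen_rising_def)
next
  case (Suc k)
  have nz: "degen_rising [:0, 1:] [:l:] k \<noteq> 0"
    using Suc by auto
  have d: "degree (degen_rising [:0, 1:] [:l:] (Suc k)) = Suc k"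
    unfolding degen_rising_poly_Suc using nz Suc by (simp add: degree_mult_eq del: mult_pCons_right)
  have "lead_coeff (degen_rising [:0, 1:] [:l:] (Suc k)) = 1"
    unfolding degen_rising_poly_Suc lead_coeff_mult using Suc by simp
  with d show ?case by simp
qed

lemma monic_expansion_unique:
  fixes e :: "nat \<Rightarrow> real poly"
  assumes e: "\<And>k. degree (e k) = k" "\<And>k. coeff (e k) k = 1"
    and z: "(\<Sum>k=0..n. smult (b k) (e k)) = 0" and "j \<le> n"
  shows "b j = 0"
  using z \<open>j \<le> n\<close>
proof (induction n)
  case 0
  then show ?case using e[of 0] by (auto dest: arg_cong[where f = "\<lambda>p. coeff p 0"])
next
  case (Suc n)
  have "coeff (\<Sum>k=0..n. smult (b k) (e k)) (Suc n) = 0"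
    by (simp add: coeff_sum) (rule sum.neutral, auto intro!: coeff_eq_0 simp: e)
  then have b: "b (Suc n) = 0"
    using arg_cong[OF Suc.prems(1), of "\<lambda>p. coeff p (Suc n)"] e(2)[of "Suc n"] by simp
  then have "(\<Sum>k=0..n. smult (b k) (e k)) = 0"
    using Suc.prems(1) by simp
  then show ?case using Suc.IH Suc.prems(2) b le_Suc_eq by auto
qed

lemma monic_expansion_exists:
  fixes e :: "nat \<Rightarrow> real poly"
  assumes e: "\<And>k. degree (e k) = k" "\<And>k. coeff (e k) k = 1"
    and "degree p \<le> n"
  shows "\<exists>a. (\<forall>k>n. a k = 0) \<and> p = (\<Sum>k=0..n. smult (a k) (e k))"
  using \<open>degree p \<le> n\<close>
proof (induction n arbitrary: p)
  case 0
  obtain c where c: "e 0 = [:c:]" using e(1)[of 0] degree_eq_zeroE by blast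
  then have "e 0 = 1" using e(2)[of 0] by (simp add: one_pCons)
  moreover obtain d where "p = [:d:]" using 0 degree_eq_zeroE by blast
  ultimately have "p = smult d (e 0)" by simp
  then show ?case by (intro exI[of _ "\<lambda>k. if k = 0 then d else 0"]) simp
next
  case (Suc n)
  define q where "q = p - smult (coeff p (Suc n)) (e (Suc n))"
  have "degree q \<le> n"
  proof (rule degree_le, intro allI impI)
    fix i assume i: "n < i"
    show "coeff q i = 0"
    proof (cases "i = Suc n")
      case True
      then show ?thesis by (simp add: q_def e)
    next
      case False
      with i have "i > Suc n" by simp
      then show ?thesis using Suc.prems by (simp add: q_def coeff_eq_0 e)
    qed
  qed
  then obtain a where a: "\<forall>k>n. a k = 0" "q = (\<Sum>k=0..n. smult (a k) (e k))"
    using Suc.IH by blast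
  let ?a = "a(Suc n := coeff p (Suc n))"
  have "p = (\<Sum>k=0..n. smult (a k) (e k)) + smult (coeff p (Suc n)) (e (Suc n))"
    using a(2) by (simp add: q_def algebra_simps)
  then have "p = (\<Sum>k=0..Suc n. smult (?a k) (e k))" by simp
  moreover have "\<forall>k>Suc n. ?a k = 0" using a(1) by auto
  ultimately show ?case by blast
qed

lemma degree_pochhammer_poly_le: "degree (pochhammer ([:0, 1:] + of_nat r :: real poly) n) \<le> n"
proof (induction n)
  case (Suc n)
  have "degree (pochhammer ([:0, 1:] + of_nat r :: real poly) n * ([:0, 1:] + of_nat r + of_nat n))
      \<le> degree (pochhammer ([:0, 1:] + of_nat r :: real poly) n)
        + degree ([:0, 1:] + of_nat r + of_nat n :: real poly)"
    by (rule degree_mult_le)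
  also have "\<dots> \<le> n + 1"
    using Suc by (intro add_mono) (simp_all add: of_nat_poly)
  finally show ?case by (simp add: pochhammer_Suc)
qed simp

lemma degen_rstirling1_row_ex1: "\<exists>!a. degen_rstirling1_row r l n a"
proof -
  let ?e = "degen_rising [:0, 1:] [:l:]"
  have e: "degree (?e k) = k" "coeff (?e k) k = 1" for k
    using degen_rising_poly_monic by blast+
  obtain a where a: "degen_rstirling1_row r l n a"
    using monic_expansion_exists[of ?e, OF e degree_pochhammer_poly_le[of r n]]
    unfolding degen_rstirling1_row_def by auto
  show ?thesis
  proof (rule ex1I[of _ a])
    show "degen_rstirling1_row r l n a" by (rule a)
  next
    fix b assume b: "degen_rstirling1_row r l n b"
    have "(\<Sum>k=0..n. smult (b k - a k) (?e k)) = 0"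
      using a b unfolding degen_rstirling1_row_def
      by (simp add: smult_diff_left sum_subtractf)
    then have "b k - a k = 0" if "k \<le> n" for k
      using monic_expansion_unique[where e = ?e and n = n and j = k and b = "\<lambda>k. b k - a k", OF e] that by blast
    moreover have "b k = a k" if "k > n" for k
      using a b that unfolding degen_rstirling1_row_def by simp
    ultimately show "b = a"
      by (metis eq_iff_diff_eq_0 ext linorder_not_le)
  qed
qed

lemma degen_rstirling1_row_holds: "degen_rstirling1_row r l n (degen_rstirling1 r l n)"
  unfolding degen_rstirling1_def by (rule theI'[OF degen_rstirling1_row_ex1])

lemma pochhammer_eq_sum_degen_rstirling1:
  "pochhammer (x + real r) n = (\<Sum>k=0..n. degen_rstirling1 r l n k * degen_rising x l k)"
proof -
  have "poly (pochhammer ([:0, 1:] + of_nat r) n) x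
      = poly (\<Sum>k=0..n. smult (degen_rstirling1 r l n k) (degen_rising [:0, 1:] [:l:] k)) x"
    using degen_rstirling1_row_holds[of r l n] by (simp add: degen_rstirling1_row_def)
  then show ?thesis
    by (simp add: pochhammer_prod poly_prod poly_sum degen_rising_def of_nat_poly
      atLeast0LessThan ac_simps)
qed

lemma degen_bernoulli_gf:
  assumes "l \<noteq> 0"
  shows "Abs_fps (\<lambda>n. full_degen_bernoulli n l x / fact n) * (fps_const l * (degen_exp l 1 - 1))
       = (fps_ln 1 oo (fps_const l * fps_X)) * degen_exp l x"
proof -
  let ?N = "fps_ln 1 oo (fps_const l * fps_X) :: real fps"
  let ?D = "fps_const l * (degen_exp l 1 - 1)"
  have D0: "?D $ 0 = 0" and D1: "?D $ 1 \<noteq> 0"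
    using assms by (simp_all add: degen_exp_def degen_falling_def)
  have N0: "?N $ 0 = 0" and N1: "?N $ 1 \<noteq> 0"
    using assms by (simp_all add: fps_compose_linear fps_ln_nth)
  have "?D \<noteq> 0" "?N \<noteq> 0" using D1 N1 by force+
  moreover have "subdegree ?D \<le> 1" by (rule subdegree_leI[OF D1])
  moreover have "1 \<le> subdegree ?N"
    by (rule subdegree_geI) (use \<open>?N \<noteq> 0\<close> N0 in auto)
  ultimately have "?N / ?D * ?D = ?N" by (intro fps_times_divide_eq) auto
  moreover have "Abs_fps (\<lambda>n. full_degen_bernoulli n l x / fact n) = ?N / ?D * degen_exp l x"
    by (rule fps_ext) (simp add: full_degen_bernoulli_def)
  moreover have "?N / ?D * degen_exp l x * ?D = ?N / ?D * ?D * degen_exp l x"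
    by (simp only: ac_simps)
  ultimately show ?thesis by simp
qed

end

theory Submission
  imports Defs
begin

text \<open>
  The proof is umbral. Let \<open>L\<close> be the linear functional on polynomials in \<open>y\<close> that sends the
  degenerate falling factorial \<open>(y)\<^sub>k\<close> to the value at \<open>x\<close> of the \<open>k\<close>-th fully degenerate
  Bernoulli polynomial.
  Since \<open>e\<^sup>y(t)\<close> is the generating function of the \<open>(y)\<^sub>k\<close>, multiplying the defining series of the
  Bernoulli polynomials by \<open>e(t) - 1\<close> amounts to applying \<open>L\<close> to a forward difference
  in \<open>y\<close>, while multiplying \<open>e\<^sup>x(t)\<close> by \<open>log (1 + l t) / l\<close> amounts to differentiating
  it in \<open>x\<close>. Hence \<open>L (q (y + 1) - q y)\<close> is the derivative of \<open>q\<close> at \<open>x\<close>, for every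
  polynomial \<open>q\<close>: on differences, \<open>L\<close> is the classical Bernoulli functional, and \<open>l\<close> has
  disappeared (\<open>bernoulli_functional_of_difference\<close>).

  Because \<open>(-1)\<^sup>k (y)\<^sub>k\<close> is the degenerate rising factorial of \<open>-y\<close>, the sum to be evaluated is
  \<open>L\<close>, taken at \<open>x = r\<close>, of the rising factorial of \<open>r - y\<close> of order \<open>n\<close>. That polynomial is the
  forward difference of minus the rising factorial of \<open>r - y\<close> of order \<open>n + 1\<close>, divided by \<open>n + 1\<close>.
  The derivative of the latter at \<open>y = r\<close> is \<open>n! / (n + 1)\<close>, because the rising factorial
  \<open>z (z + 1) \<dots> (z + n)\<close> has a simple root at \<open>z = 0\<close> with slope \<open>n!\<close>.
\<close>

section \<open>Degenerate falling factorials\<close>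

lemma degen_falling_Suc_left:
  "degen_falling x l (Suc n) = x * (\<Prod>i<n. x - of_nat (Suc i) * l)"
  by (simp only: degen_falling_def prod.lessThan_Suc_shift) simp

lemma degen_rising_uminus:
  "degen_rising (- x) l k = (-1) ^ k * degen_falling x l k"
proof -
  have "degen_rising (- x) l k = (\<Prod>i<k. (-1) * (x - of_nat i * l))"
    unfolding degen_rising_def by (intro prod.cong) auto
  also have "\<dots> = (-1) ^ k * degen_falling x l k"
    by (simp only: prod.distrib degen_falling_def) simp
  finally show ?thesis .
qed

text \<open>
  The values at \<open>0, l, 2 l, \<dots>\<close> form a triangular system with nonzero diagonal, since \<open>(j l)\<^sub>k\<close>
  vanishes exactly when \<open>k > j\<close>. This is what makes the functional \<open>L\<close> well defined.
\<close>

lemma degen_falling_coeffs_unique: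
  fixes l :: real
  assumes l: "l \<noteq> 0"
    and eq: "\<And>y. (\<Sum>k\<le>N. a k * degen_falling y l k) = (\<Sum>k\<le>N. b k * degen_falling y l k)"
    and "j \<le> N"
  shows "a j = b j"
  using \<open>j \<le> N\<close>
proof (induction j rule: less_induct)
  case (less j)
  have zero: "degen_falling (real j * l) l k = 0" if "k > j" for k
    using that by (auto simp: degen_falling_def)
  have nz: "degen_falling (real j * l) l j \<noteq> 0"
    using l by (auto simp: degen_falling_def)
  have split: "(\<Sum>k\<le>N. c k * degen_falling (real j * l) l k)
      = (\<Sum>k<j. c k * degen_falling (real j * l) l k) + c j * degen_falling (real j * l) l j"
    for c :: "nat \<Rightarrow> real"
  proof -
    have "(\<Sum>k\<le>N. c k * degen_falling (real j * l) l k)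
        = (\<Sum>k\<le>j. c k * degen_falling (real j * l) l k)"
      by (rule sum.mono_neutral_right) (use less.prems zero in auto)
    then show ?thesis
      by (simp add: lessThan_Suc_atMost[symmetric])
  qed
  have "(\<Sum>k<j. a k * degen_falling (real j * l) l k)
      = (\<Sum>k<j. b k * degen_falling (real j * l) l k)"
    using less.IH less.prems by (intro sum.cong) auto
  then show ?case
    using eq[of "real j * l"] nz unfolding split by simp
qed

section \<open>Degenerate exponentials\<close>

text \<open>The series is \<open>(1 + l t)\<close> to the power \<open>x / l\<close>, so the law of exponents is that of the binomial series.\<close>

lemma degen_exp_eq_binomial:
  fixes l x :: real
  assumes "l \<noteq> 0"
  shows "degen_exp l x = fps_binomial (x / l) oo (fps_const l * fps_X)"
proof (rule fps_ext)
  fix n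
  have "degen_falling x l n = (\<Prod>i<n. l * (x / l - of_nat i))"
    unfolding degen_falling_def using assms by (intro prod.cong) (auto simp: field_simps)
  then have "degen_falling x l n = l ^ n * (\<Prod>i<n. x / l - of_nat i)"
    by (simp add: prod.distrib)
  then show "degen_exp l x $ n = (fps_binomial (x / l) oo (fps_const l * fps_X)) $ n"
    by (simp add: degen_exp_def fps_compose_linear gbinomial_prod_rev atLeast0LessThan)
qed

lemma degen_exp_add:
  fixes l x y :: real
  assumes "l \<noteq> 0"
  shows "degen_exp l (x + y) = degen_exp l x * degen_exp l y"
  by (simp add: degen_exp_eq_binomial[OF assms] add_divide_distrib fps_binomial_add_mult
      fps_compose_mult_distrib)

text \<open>Comparing coefficients in the law of exponents gives the degenerate Vandermonde identity.\<close>

lemma degen_falling_add: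
  fixes l x y :: real
  assumes "l \<noteq> 0"
  shows "degen_falling (x + y) l m / fact m
       = (\<Sum>i=0..m. (degen_falling x l i / fact i) * (degen_falling y l (m - i) / fact (m - i)))"
  using arg_cong[OF degen_exp_add[OF assms, of x y], of "\<lambda>f. f $ m"]
  by (simp add: degen_exp_def fps_mult_nth)

lemma has_field_derivative_mult_self_0:
  fixes g :: "real \<Rightarrow> real"
  assumes "isCont g 0"
  shows "((\<lambda>z. z * g z) has_field_derivative g 0) (at 0)"
  unfolding CARAT_DERIV using assms by (intro exI[of _ g]) (auto simp: mult.commute)

lemma degen_falling_has_derivative_0:
  fixes l :: real
  assumes "l \<noteq> 0"
  shows "((\<lambda>h. degen_falling h l i / fact i) has_field_derivative
      (fps_const (1 / l) * (fps_ln 1 oo (fps_const l * fps_X))) $ i) (at 0)"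
proof (cases i)
  case 0
  then show ?thesis by (simp add: degen_falling_def fps_compose_linear fps_ln_nth)
next
  case (Suc j)
  have p: "(\<Prod>t<j. - (real (Suc t) * l)) = (- l) ^ j * fact j"
    by (induction j) (simp_all add: algebra_simps)
  have "((\<lambda>h. h * (\<Prod>t<j. h - real (Suc t) * l)) has_field_derivative (- l) ^ j * fact j) (at 0)"
    using has_field_derivative_mult_self_0[of "\<lambda>h. \<Prod>t<j. h - real (Suc t) * l"] p
    by (simp add: continuous_intros)
  then have "((\<lambda>h. degen_falling h l i / fact i) has_field_derivative
      (- l) ^ j * fact j / fact i) (at 0)"
    unfolding Suc degen_falling_Suc_left by (rule DERIV_cdivide)
  also have "(- l) ^ j * fact j / fact i
      = (fps_const (1 / l) * (fps_ln 1 oo (fps_const l * fps_X))) $ i"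
    using assms Suc by (simp add: fps_compose_linear fps_ln_nth power_minus[of l])
  finally show ?thesis .
qed

text \<open>
  Formally \<open>e\<^sup>x(t) = exp (x log (1 + l t) / l)\<close>, so its \<open>x\<close>-derivative is \<open>e\<^sup>x(t) log (1 + l t) / l\<close>.
  Coefficientwise this follows by differentiating \<open>e\<^sup>h(t) e\<^sup>x(t)\<close> at \<open>h = 0\<close>.
\<close>

lemma degen_falling_has_derivative:
  fixes l x :: real
  assumes "l \<noteq> 0"
  shows "((\<lambda>y. degen_falling y l m / fact m) has_field_derivative
      (fps_const (1 / l) * (fps_ln 1 oo (fps_const l * fps_X)) * degen_exp l x) $ m) (at x)"
proof -
  have "((\<lambda>h. \<Sum>i=0..m. (degen_falling h l i / fact i) * (degen_falling x l (m - i) / fact (m - i)))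
      has_field_derivative
      (\<Sum>i=0..m. (fps_const (1 / l) * (fps_ln 1 oo (fps_const l * fps_X))) $ i
        * (degen_falling x l (m - i) / fact (m - i)))) (at 0)"
    by (intro DERIV_sum DERIV_cmult_right degen_falling_has_derivative_0 assms)
  then have "((\<lambda>h. degen_falling (h + x) l m / fact m) has_field_derivative
      (fps_const (1 / l) * (fps_ln 1 oo (fps_const l * fps_X)) * degen_exp l x) $ m) (at 0)"
    unfolding degen_falling_add[OF assms] by (simp only: fps_mult_nth[of "_ * _"] degen_exp_def fps_nth_Abs_fps)
  then show ?thesis
    using DERIV_shift[of "\<lambda>y. degen_falling y l m / fact m" _ 0 x] by simp
qed

section \<open>The Bernoulli functional\<close>

text \<open>
  Coefficient comparison in the defining series: \<open>B(t) e(t) = B(t) + e\<^sup>x(t) log (1 + l t) / l\<close>, where \<open>B\<close>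
  is the generating function of the Bernoulli polynomials at \<open>x\<close>. In terms of the functional it
  reads \<open>L ((y + 1)\<^sub>m) = L ((y)\<^sub>m) + D\<close>, with \<open>(y + 1)\<^sub>m\<close> expanded by the Vandermonde identity.
\<close>

lemma full_degen_bernoulli_recurrence:
  fixes l x :: real
  assumes l: "l \<noteq> 0"
    and D: "((\<lambda>y. degen_falling y l m) has_field_derivative D) (at x)"
  shows "(\<Sum>k=0..m. real (m choose k) * degen_falling 1 l (m - k) * full_degen_bernoulli k l x)
       = full_degen_bernoulli m l x + D"
proof -
  define B where "B = Abs_fps (\<lambda>n. full_degen_bernoulli n l x / fact n)"
  define N where "N = (fps_ln 1 oo (fps_const l * fps_X) :: real fps)"
  have "fps_const (1 / l) * (B * (fps_const l * (degen_exp l 1 - 1)))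
      = fps_const (1 / l) * (N * degen_exp l x)"
    using degen_bernoulli_gf[OF l, of x] by (simp add: B_def N_def)
  moreover have "fps_const (1 / l) * (B * (fps_const l * (degen_exp l 1 - 1)))
      = (fps_const (1 / l) * fps_const l) * (B * (degen_exp l 1 - 1))"
    by (simp only: ac_simps)
  moreover have "fps_const (1 / l) * fps_const l = 1"
    using l by simp
  ultimately have "B * degen_exp l 1 = B + fps_const (1 / l) * N * degen_exp l x"
    by (simp add: algebra_simps)
  then have "(B * degen_exp l 1) $ m = B $ m + (fps_const (1 / l) * N * degen_exp l x) $ m"
    by simp
  moreover have "(fps_const (1 / l) * N * degen_exp l x) $ m = D / fact m"
    using DERIV_unique[OF degen_falling_has_derivative[OF l] DERIV_cdivide[OF D]]
    by (simp add: N_def)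
  ultimately have "fact m * (B * degen_exp l 1) $ m = full_degen_bernoulli m l x + D"
    by (simp add: B_def distrib_left)
  moreover have "fact m * (B * degen_exp l 1) $ m
      = (\<Sum>k=0..m. real (m choose k) * degen_falling 1 l (m - k) * full_degen_bernoulli k l x)"
    unfolding fps_mult_nth sum_distrib_left
    by (intro sum.cong) (auto simp: B_def degen_exp_def binomial_fact)
  ultimately show ?thesis by simp
qed

text \<open>
  The recurrence is the case \<open>q y = (y)\<^sub>m\<close>, and both sides are linear in \<open>q\<close>. Here \<open>L\<close> is given by
  its effect on coefficients, so linearity rests on their uniqueness: expanding \<open>q (y + 1)\<close> either
  from \<open>a + b\<close> or term by term with Vandermonde must give the same coefficients.
\<close>

lemma bernoulli_functional_of_difference:
  fixes l x :: real
  assumes l: "l \<noteq> 0"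
    and q: "\<And>y. q y = (\<Sum>m\<le>N. b m * degen_falling y l m)"
    and diff: "\<And>y. q (y + 1) - q y = (\<Sum>k\<le>N. a k * degen_falling y l k)"
    and D: "(q has_field_derivative D) (at x)"
  shows "(\<Sum>k\<le>N. a k * full_degen_bernoulli k l x) = D"
proof -
  \<comment> \<open>Binomial coefficients vanish above the diagonal, so every expansion can run up to \<open>N\<close>.\<close>
  define c where "c m k = real (m choose k) * degen_falling 1 l (m - k)" for m k
  have extend: "(\<Sum>k=0..m. c m k * f k) = (\<Sum>k\<le>N. c m k * f k)" if "m \<le> N" for m f
    by (rule sum.mono_neutral_left) (use that in \<open>auto simp: c_def\<close>)
  have swap: "(\<Sum>m\<le>N. b m * (\<Sum>k\<le>N. c m k * f k)) = (\<Sum>k\<le>N. (\<Sum>m\<le>N. b m * c m k) * f k)" for f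
    by (simp only: sum_distrib_left sum_distrib_right mult.assoc) (rule sum.swap)
  have shift: "degen_falling (y + 1) l m = (\<Sum>k=0..m. c m k * degen_falling y l k)" for y m
  proof -
    have "degen_falling (y + 1) l m = fact m * (degen_falling (y + 1) l m / fact m)"
      by simp
    also have "\<dots> = (\<Sum>k=0..m. c m k * degen_falling y l k)"
      unfolding degen_falling_add[OF l] sum_distrib_left
      by (intro sum.cong) (auto simp: c_def binomial_fact)
    finally show ?thesis .
  qed
  have "(\<Sum>k\<le>N. (a k + b k) * degen_falling y l k)
      = (\<Sum>k\<le>N. (\<Sum>m\<le>N. b m * c m k) * degen_falling y l k)" for y
  proof -
    have "(\<Sum>k\<le>N. (a k + b k) * degen_falling y l k) = q (y + 1)"
      using diff[of y] q[of y] by (simp add: distrib_right sum.distrib)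
    also have "\<dots> = (\<Sum>m\<le>N. b m * (\<Sum>k\<le>N. c m k * degen_falling y l k))"
      unfolding q shift by (intro sum.cong) (auto simp: extend)
    finally show ?thesis unfolding swap .
  qed
  then have coeffs: "a k + b k = (\<Sum>m\<le>N. b m * c m k)" if "k \<le> N" for k
    by (rule degen_falling_coeffs_unique[OF l _ that])
  have "\<exists>d. ((\<lambda>y. degen_falling y l m) has_field_derivative d) (at x)" for m
    using DERIV_cmult[OF degen_falling_has_derivative[OF l, of m x], of "fact m"] by auto
  then obtain d where d: "((\<lambda>y. degen_falling y l m) has_field_derivative d m) (at x)" for m
    by metis
  have "(q has_field_derivative (\<Sum>m\<le>N. b m * d m)) (at x)"
    unfolding q[abs_def] by (intro DERIV_sum DERIV_cmult d)
  then have D_eq: "D = (\<Sum>m\<le>N. b m * d m)"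
    using D by (rule DERIV_unique[symmetric])
  have "(\<Sum>k\<le>N. (a k + b k) * full_degen_bernoulli k l x)
      = (\<Sum>m\<le>N. b m * (\<Sum>k\<le>N. c m k * full_degen_bernoulli k l x))"
    unfolding swap by (intro sum.cong) (auto simp: coeffs)
  also have "\<dots> = (\<Sum>m\<le>N. b m * (full_degen_bernoulli m l x + d m))"
  proof (intro sum.cong refl)
    fix m assume "m \<in> {..N}"
    then show "b m * (\<Sum>k\<le>N. c m k * full_degen_bernoulli k l x)
        = b m * (full_degen_bernoulli m l x + d m)"
      using full_degen_bernoulli_recurrence[OF l d[of m]] extend[of m "\<lambda>k. full_degen_bernoulli k l x"]
      by (simp add: c_def)
  qed
  finally show ?thesis
    by (simp add: D_eq distrib_left distrib_right sum.distrib)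
qed

section \<open>The rising factorial as a forward difference\<close>

lemma pochhammer_backward_difference:
  fixes z :: real
  shows "pochhammer z (Suc n) - pochhammer (z - 1) (Suc n) = (real n + 1) * pochhammer z n"
  by (simp add: pochhammer_rec[of "z - 1"] pochhammer_Suc[of z] algebra_simps)

lemma pochhammer_has_derivative_0:
  "((\<lambda>z::real. pochhammer z (Suc n)) has_field_derivative fact n) (at 0)"
proof -
  have "isCont (\<lambda>z::real. pochhammer (z + 1) n) 0"
    unfolding pochhammer_prod by (intro continuous_intros)
  from has_field_derivative_mult_self_0[OF this] show ?thesis
    by (simp add: pochhammer_rec pochhammer_fact)
qed

lemma pochhammer_eq_sum_degen_falling:
  "pochhammer (real r - y) n
     = (\<Sum>k\<le>n. ((-1) ^ k * degen_rstirling1 r l n k) * degen_falling y l k)"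
  using pochhammer_eq_sum_degen_rstirling1[of "- y" r n l]
  by (simp add: degen_rising_uminus atMost_atLeast0 mult_ac)

theorem corollary3:
  fixes l :: real and r n :: nat
  assumes "l \<noteq> 0"
  shows "fact n / (real n + 1) =
    (\<Sum>k=0..n. (-1) ^ k * degen_rstirling1 r l n k * full_degen_bernoulli k l (real r))"
proof -
  define s where "s i k = (-1) ^ k * degen_rstirling1 r l i k" for i k
  define q where "q y = - pochhammer (real r - y) (Suc n) / (real n + 1)" for y
  \<comment> \<open>\<open>q\<close> has degree \<open>n + 1\<close> and its difference only degree \<open>n\<close>; padding with this zero gives both
    expansions the same length.\<close>
  have s_above: "s n (Suc n) = 0"
    using degen_rstirling1_row_holds[of r l n] by (simp add: s_def degen_rstirling1_row_def)
  have q: "q y = (\<Sum>m\<le>Suc n. (- s (Suc n) m / (real n + 1)) * degen_falling y l m)" for y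
    unfolding q_def pochhammer_eq_sum_degen_falling[where l = l]
    by (simp only: s_def sum_negf[symmetric] sum_divide_distrib) (intro sum.cong, auto)
  have diff: "q (y + 1) - q y = (\<Sum>k\<le>Suc n. s n k * degen_falling y l k)" for y
  proof -
    have "q (y + 1) - q y
        = (pochhammer (real r - y) (Suc n) - pochhammer (real r - y - 1) (Suc n)) / (real n + 1)"
      by (simp add: q_def diff_divide_distrib algebra_simps)
    also have "\<dots> = pochhammer (real r - y) n"
      unfolding pochhammer_backward_difference by simp
    also have "\<dots> = (\<Sum>k\<le>Suc n. s n k * degen_falling y l k)"
      using s_above by (simp add: pochhammer_eq_sum_degen_falling[where l = l] s_def)
    finally show ?thesis .
  qed
  have "((\<lambda>y. pochhammer (real r - y) (Suc n)) has_field_derivative fact n * (- 1)) (at (real r))"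
    by (rule DERIV_chain2[where f = "\<lambda>z. pochhammer z (Suc n)"])
      (use pochhammer_has_derivative_0[of n] in \<open>auto intro!: derivative_eq_intros\<close>)
  then have "((\<lambda>y. - pochhammer (real r - y) (Suc n) / (real n + 1))
      has_field_derivative - (fact n * (- 1)) / (real n + 1)) (at (real r))"
    by (intro DERIV_cdivide DERIV_minus)
  then have "(q has_field_derivative fact n / (real n + 1)) (at (real r))"
    unfolding q_def[abs_def] by simp
  from bernoulli_functional_of_difference[OF assms q diff this] s_above
  show ?thesis
    by (simp add: s_def atMost_atLeast0)
qed

end
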